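(* Let $n$ be a non-negative integer, let $0\le\alpha<1$, and let $\beta$ be a positive real number with $\beta\ge e(1-\alpha)$ when $n=0$, and $\beta\ge e^{n-1}(1-\alpha)$ when $n\neq 0$. If a function $f\in\mathcal{H}$ satisfies the subordination $$1+\beta\left(\frac{zf'(z)}{f(z)}\right)^{1-n}\left(1-\frac{zf'(z)}{f(z)}+\frac{zf''(z)}{f'(z)}\right)\prec 1+(1-\alpha)z,$$ then $f\in\mathcal{S}^*_e$.
   Context: $\mathbb{D}=\{z\in\mathbb{C}:|z|<1\}$. $\mathcal{H}$ is the class of analytic functions $f$ on $\mathbb{D}$ with $f(0)=0$ and $f'(0)=1$. For functions $F,G$ analytic in $\mathbb{D}$, $F\prec G$ ($F$ is subordinate to $G$) means that there is an analytic function $w$ on $\mathbb{D}$ with $w(0)=0$, $|w(z)|<1$ and $F(z)=G(w(z))$ for all $z\in\mathbb{D}$. $\mathcal{S}^*_e$ is the class of $f\in\mathcal{H}$ with $zf'(z)/f(z)\prec e^z$. *)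

theory Defs
  imports "HOL-Complex_Analysis.Complex_Analysis"
begin

abbreviation unit_disc :: "complex set" where
  "unit_disc \<equiv> ball 0 1"

definition class_H :: "(complex \<Rightarrow> complex) set" where
  "class_H = {f. f holomorphic_on unit_disc \<and> f 0 = 0 \<and> deriv f 0 = 1}"

definition subordinate :: "(complex \<Rightarrow> complex) \<Rightarrow> (complex \<Rightarrow> complex) \<Rightarrow> bool" where
  "subordinate F G \<longleftrightarrow>
     F holomorphic_on unit_disc \<and> G holomorphic_on unit_disc \<and>
     (\<exists>w. w holomorphic_on unit_disc \<and> w 0 = 0 \<and>
        (\<forall>z\<in>unit_disc. norm (w z) < 1 \<and> F z = G (w z)))"

(* z f'(z) / f(z) is a quotient 0 / 0 at the origin, where the analytic function it denotes has
   the value 1; in HOL the bare quotient has the value 0 there.  Expressions built from quotients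
   are therefore passed through remove_sings, which replaces values at removable singularities
   by limits.  A pole is not removed, so the holomorphy demanded by subordinate excludes it;
   in particular z f'(z) / f(z) subordinate to exp forces f(z) to be nonzero for 0 < |z| < 1. *)

definition class_S_e :: "(complex \<Rightarrow> complex) set" where
  "class_S_e = {f \<in> class_H. subordinate (remove_sings (\<lambda>z. z * deriv f z / f z)) exp}"

end

theory Submission
  imports Defs
begin

text \<open>
  Write \<open>p(z) = z f'(z) / f(z)\<close>.  The hypothesis says \<open>\<beta> z p' p\<^sup>-\<^sup>n = (1 - \<alpha>) w\<close> with a Schwarz
  function \<open>w(z) = z v(z)\<close>, so near the origin \<open>l = log p\<close> satisfies \<open>l' exp (a l) = c v\<close> with
  \<open>a = 1 - n\<close> and \<open>c = (1 - \<alpha>) / \<beta>\<close>.  If \<open>U\<close> is the primitive of \<open>c v\<close>, then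
  \<open>l = log (1 + a U) / a\<close> (or \<open>l = U\<close> if \<open>a = 0\<close>).  The right-hand side \<open>W\<close> is defined on the whole
  disc, and \<open>|W| < 1\<close> because \<open>|a| c \<le> 1 - exp (-|a|)\<close>, which reduces to \<open>1 + m \<le> exp m\<close>.
  The identity theorem extends \<open>z f' = exp W f\<close> from a neighbourhood of the origin to the disc; by
  uniqueness for linear differential equations \<open>f\<close> has no zero besides the origin, so \<open>p = exp W\<close>.
\<close>

section \<open>Uniqueness for first-order equations on a disc\<close>

lemma has_field_derivative_eq_on_ball:
  fixes f g :: "complex \<Rightarrow> complex"
  assumes "\<And>z. z \<in> ball 0 r \<Longrightarrow> (f has_field_derivative D z) (at z)"
    and "\<And>z. z \<in> ball 0 r \<Longrightarrow> (g has_field_derivative D z) (at z)"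
    and "f 0 = g 0" and "z \<in> ball 0 r"
  shows "f z = g z"
proof -
  have "((\<lambda>z. f z - g z) has_field_derivative 0) (at z within ball 0 r)" if "z \<in> ball 0 r" for z
    using DERIV_diff[OF assms(1,2)[OF that]] by (simp add: has_field_derivative_at_within)
  then obtain k where k: "\<And>z. z \<in> ball 0 r \<Longrightarrow> f z - g z = k"
    using has_field_derivative_zero_constant[OF convex_ball, of 0 r "\<lambda>z. f z - g z"] by metis
  have "0 \<in> ball (0::complex) r"
    using assms(4) order_le_less_trans[OF norm_ge_zero, of z r] by simp
  from k[OF this] k[OF assms(4)] assms(3) show ?thesis by simp
qed

text \<open>Integrating factor: with \<open>K\<close> a primitive of \<open>L\<close>, the product
  \<open>F z * exp (- K z)\<close> has derivative 0, so it keeps its nonzero value at the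
  origin.\<close>

lemma linear_ODE_solution_nonzero:
  fixes F L :: "complex \<Rightarrow> complex"
  assumes "L holomorphic_on ball 0 r"
    and F: "\<And>z. z \<in> ball 0 r \<Longrightarrow> (F has_field_derivative L z * F z) (at z)"
    and "F 0 \<noteq> 0" and z: "z \<in> ball 0 r"
  shows "F z \<noteq> 0"
proof -
  obtain K where K: "\<And>z. z \<in> ball 0 r \<Longrightarrow> (K has_field_derivative L z) (at z)"
    using holomorphic_convex_primitive'[OF convex_ball open_ball assms(1)]
    by (metis at_within_open open_ball)
  have "((\<lambda>z. F z * exp (- K z)) has_field_derivative 0) (at z)" if "z \<in> ball 0 r" for z
    by (rule derivative_eq_intros F K that refl)+ (simp add: algebra_simps)
  moreover have "((\<lambda>z. F 0 * exp (- K 0)) has_field_derivative 0) (at z)" for z :: complex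
    by simp
  ultimately have "F z * exp (- K z) = F 0 * exp (- K 0)"
    using has_field_derivative_eq_on_ball[of r "\<lambda>z. F z * exp (- K z)" "\<lambda>_. 0"
        "\<lambda>z. F 0 * exp (- K 0)"] z by blast
  with assms(3) show ?thesis by auto
qed

section \<open>Estimates for the logarithm and for the constants\<close>

lemma norm_Ln_one_plus_le:
  fixes u :: complex
  assumes "norm u < 1"
  shows "norm (Ln (1 + u)) \<le> - ln (1 - norm u)"
proof -
  \<comment> \<open>The moduli of the terms of the series of \<open>Ln (1 + u)\<close>; the term at
    0 vanishes because division by 0 yields 0.\<close>
  have s: "(\<lambda>n. norm u ^ n / of_nat n) sums - ln (1 - norm u)"
    using sums_minus[OF ln_series'[of "- norm u"]] assms by simp
  have "norm (Ln (1 + u)) \<le> (\<Sum>n. norm u ^ n / of_nat n)"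
    unfolding sums_unique[OF Ln_series'[OF assms]]
    by (rule norm_suminf_le) (use s in \<open>auto simp: norm_divide norm_power sums_iff\<close>)
  with s show ?thesis by (simp add: sums_iff)
qed

text \<open>The function - ln (1 - t) is increasing and takes the value \<open>M\<close> at t = 1 -
  exp (-M).\<close>

lemma norm_Ln_one_plus_less:
  fixes u :: complex
  assumes "norm u < 1 - exp (- M)"
  shows "norm (Ln (1 + u)) < M"
proof -
  have 1: "norm u < 1" using assms by (smt (verit) exp_gt_zero)
  have "exp (- M) < 1 - norm u" using assms by simp
  then have "ln (exp (- M)) < ln (1 - norm u)"
    using 1 by (subst ln_less_cancel_iff) auto
  with norm_Ln_one_plus_le[OF 1] show ?thesis by simp
qed

text \<open>For n = 0 this reduces to 2 \<le> e. Otherwise, with m = n - 1, the inequality m exp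
  (-m) \<le> 1 - exp (-m) is 1 + m \<le> exp m.\<close>

lemma mult_exp_minus_abs_le:
  fixes n :: nat and c :: real
  assumes "n = 0 \<Longrightarrow> c \<le> exp (- 1)" and "n \<noteq> 0 \<Longrightarrow> c \<le> exp (1 - real n)"
  shows "\<bar>1 - real n\<bar> * c \<le> 1 - exp (- \<bar>1 - real n\<bar>)"
proof (cases "n = 0")
  case True
  have "2 * exp (- 1 :: real) \<le> 1"
    using exp_ge_add_one_self[of "1::real"] by (simp add: exp_minus field_simps)
  with True assms(1) show ?thesis by simp
next
  case False
  define m where "m = real n - 1"
  have m: "m \<ge> 0" "\<bar>1 - real n\<bar> = m" using False by (auto simp: m_def)
  have "m * c \<le> m * exp (- m)"
    using assms(2)[OF False] m by (intro mult_left_mono) (auto simp: m_def)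
  also have "\<dots> \<le> 1 - exp (- m)"
    using exp_ge_add_one_self[of m] by (simp add: exp_minus field_simps)
  finally show ?thesis by (simp add: m)
qed

section \<open>The explicit solution on the whole disc and the local logarithm\<close>

text \<open>The equation integrates to exp (a l) = 1 + a U with U' = g. The last conclusion speaks
  of solutions on smaller discs, so that a logarithm known only near the origin can be identified
  with \<open>W\<close>.\<close>

lemma exp_weighted_ODE_global_solution:
  fixes a c :: real and g :: "complex \<Rightarrow> complex"
  assumes g: "g holomorphic_on unit_disc"
    and gle: "\<And>z. z \<in> unit_disc \<Longrightarrow> norm (g z) \<le> c" and c: "c > 0"
    and c1: "a = 0 \<Longrightarrow> c \<le> 1" and c2: "\<bar>a\<bar> * c \<le> 1 - exp (- \<bar>a\<bar>)"
  obtains W where "W holomorphic_on unit_disc" "W 0 = 0" "\<And>z. z \<in> unit_disc \<Longrightarrow> norm (W z) < 1"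
    "\<And>r l l' z. \<lbrakk>r \<le> 1; \<And>z. z \<in> ball 0 r \<Longrightarrow> (l has_field_derivative l' z) (at z); l 0 = 0;
       \<And>z. z \<in> ball 0 r \<Longrightarrow> norm (of_real a * l z) < pi;
       \<And>z. z \<in> ball 0 r \<Longrightarrow> exp (of_real a * l z) * l' z = g z; z \<in> ball 0 r\<rbrakk> \<Longrightarrow> l z = W z"
proof -
  obtain U0 where U0: "\<And>z. z \<in> unit_disc \<Longrightarrow> (U0 has_field_derivative g z) (at z)"
    using holomorphic_convex_primitive'[OF convex_ball open_ball g]
    by (metis at_within_open open_ball)
  define U where "U z = U0 z - U0 0" for z
  have U: "(U has_field_derivative g z) (at z)" if "z \<in> unit_disc" for z
    unfolding U_def using U0[OF that] by (auto intro!: derivative_eq_intros)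
  have U_0: "U 0 = 0" by (simp add: U_def)
  have Uhol: "U holomorphic_on unit_disc"
    using U by (metis holomorphic_on_open open_ball)
  have Ule: "norm (U z) < c" if "z \<in> unit_disc" for z
  proof -
    have "norm (U z - U 0) \<le> c * norm (z - 0)"
      by (rule field_differentiable_bound[OF convex_ball[of 0 1]])
         (use U gle that in \<open>auto intro: has_field_derivative_at_within\<close>)
    also have "\<dots> < c * 1" using that c by (intro mult_strict_left_mono) auto
    finally show ?thesis by (simp add: U_0)
  qed
  define W where "W z = (if a = 0 then U z else Ln (1 + of_real a * U z) / of_real a)" for z
  have aU: "norm (of_real a * U z) < 1 - exp (- \<bar>a\<bar>)" if "a \<noteq> 0" "z \<in> unit_disc" for z
  proof -
    have "norm (of_real a * U z) < \<bar>a\<bar> * c"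
      using Ule[OF that(2)] that(1) by (simp add: norm_mult)
    with c2 show ?thesis by simp
  qed
  have nonpos: "1 + of_real a * U z \<notin> \<real>\<^sub>\<le>\<^sub>0" if "a \<noteq> 0" "z \<in> unit_disc" for z
  proof -
    have "norm (of_real a * U z) < 1"
      using aU[OF that] exp_gt_zero[of "- \<bar>a\<bar>"] by linarith
    \<comment> \<open>The right half-plane avoids the branch cut of \<open>Ln\<close>.\<close>
    then have "Re (1 + of_real a * U z) > 0"
      using abs_Re_le_cmod[of "of_real a * U z"] unfolding plus_complex.sel one_complex.sel
      by linarith
    then show ?thesis by (auto simp: complex_nonpos_Reals_iff)
  qed
  show ?thesis
  proof (rule that[of W])
    show "W holomorphic_on unit_disc"
    proof (cases "a = 0")
      case True
      then show ?thesis using Uhol by (simp add: W_def[abs_def])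
    next
      case False
      have "(\<lambda>z. Ln (1 + of_real a * U z) / of_real a) holomorphic_on unit_disc"
        by (intro holomorphic_intros Uhol) (use False nonpos in auto)
      then show ?thesis using False by (simp add: W_def[abs_def])
    qed
    show "W 0 = 0" by (simp add: W_def U_0)
    show "norm (W z) < 1" if "z \<in> unit_disc" for z
    proof (cases "a = 0")
      case True
      then show ?thesis using Ule[OF that] c1 by (simp add: W_def)
    next
      case False
      \<comment> \<open>The logarithm has modulus below |a|; dividing by \<open>a\<close> gives the
        bound 1.\<close>
      then show ?thesis using norm_Ln_one_plus_less[OF aU[OF False that]]
        by (simp add: W_def norm_divide)
    qed
  next
    fix r :: real and l l' :: "complex \<Rightarrow> complex" and z :: complex
    assume r: "r \<le> 1"
      and l: "\<And>z. z \<in> ball 0 r \<Longrightarrow> (l has_field_derivative l' z) (at z)" and l0: "l 0 = 0"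
      and pi: "\<And>z. z \<in> ball 0 r \<Longrightarrow> norm (of_real a * l z) < pi"
      and ode: "\<And>z. z \<in> ball 0 r \<Longrightarrow> exp (of_real a * l z) * l' z = g z"
      and z: "z \<in> ball 0 r"
    have sub: "z \<in> unit_disc" if "z \<in> ball 0 r" for z using that r by simp
    show "l z = W z"
    proof (cases "a = 0")
      case True
      have "l z = U z"
        by (rule has_field_derivative_eq_on_ball[of r l l' U])
           (use l U ode sub z l0 U_0 True in auto)
      then show ?thesis using True by (simp add: W_def)
    next
      case False
      have "exp (of_real a * l z) = 1 + of_real a * U z"
      proof (rule has_field_derivative_eq_on_ball[of r "\<lambda>z. exp (of_real a * l z)"
            "\<lambda>z. of_real a * g z" "\<lambda>z. 1 + of_real a * U z"])
        show "((\<lambda>z. exp (of_real a * l z)) has_field_derivative of_real a * g z) (at z)"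
          if "z \<in> ball 0 r" for z
          by (rule derivative_eq_intros l that refl)+ (simp add: ode[OF that, symmetric])
        show "((\<lambda>z. 1 + of_real a * U z) has_field_derivative of_real a * g z) (at z)"
          if "z \<in> ball 0 r" for z
          by (rule derivative_eq_intros U sub that refl)+ simp
      qed (use l0 U_0 z in auto)
      \<comment> \<open>The bound by \<open>pi\<close> puts a l(z) into the strip where the
        principal logarithm inverts \<open>exp\<close>.\<close>
      moreover have "Ln (exp (of_real a * l z)) = of_real a * l z"
        using abs_Im_le_cmod[of "of_real a * l z"] pi[OF z] by (intro Ln_exp) linarith+
      ultimately show ?thesis using False by (simp add: W_def)
    qed
  qed
qed

text \<open>Applied with F(z) = f(z) / z, so that \<open>f' z / F z\<close> is z f' / f with the
  singularity at 0 removed. It is continuous with value 1 at 0; hence near 0 it stays in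
  \<open>ball 1 1\<close>, off the branch cut, and its logarithm is small.\<close>

lemma local_logarithm_of_log_derivative:
  fixes F f' :: "complex \<Rightarrow> complex" and a :: real
  assumes F: "F holomorphic_on unit_disc" and f': "f' holomorphic_on unit_disc"
    and F0: "F 0 = 1" and f'0: "f' 0 = 1"
  obtains r l where "0 < r" "r \<le> 1" "l holomorphic_on ball 0 r" "l 0 = 0"
    "\<And>z. z \<in> ball 0 r \<Longrightarrow> norm (of_real a * l z) < 1"
    "\<And>z. z \<in> ball 0 r \<Longrightarrow> F z \<noteq> 0"
    "\<And>z. z \<in> ball 0 r \<Longrightarrow> f' z = F z * exp (l z)"
proof -
  have cF: "isCont F 0" and cf': "isCont f' 0"
    using F f' by (auto intro!: continuous_on_interior[OF holomorphic_on_imp_continuous_on])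
  have cl: "isCont (\<lambda>z. Ln (f' z / F z)) 0"
    using cF cf' F0 f'0 by (intro continuous_intros isCont_Ln') auto
  have e1: "\<forall>\<^sub>F z in nhds 0. F z \<noteq> 0"
    using cF F0 by (intro tendsto_imp_eventually_ne[of F 1]) (auto simp: isCont_def tendsto_nhds_iff)
  have "((\<lambda>z. f' z / F z) \<longlongrightarrow> 1) (nhds 0)"
    using cF cf' F0 f'0 tendsto_divide[of f' 1 "nhds 0" F 1]
    by (auto simp: isCont_def tendsto_nhds_iff)
  then have e2: "\<forall>\<^sub>F z in nhds 0. f' z / F z \<in> ball 1 1"
    by (rule topological_tendstoD) auto
  have "((\<lambda>z. of_real a * Ln (f' z / F z)) \<longlongrightarrow> 0) (nhds 0)"
    using cl F0 f'0 tendsto_mult_left[of "\<lambda>z. Ln (f' z / F z)" 0 "nhds 0" "of_real a"]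
    by (auto simp: isCont_def tendsto_nhds_iff)
  then have e3: "\<forall>\<^sub>F z in nhds 0. of_real a * Ln (f' z / F z) \<in> ball 0 1"
    by (rule topological_tendstoD) auto
  from eventually_conj[OF e1 eventually_conj[OF e2 e3]]
  obtain r0 where "r0 > 0" and r0: "\<And>z. z \<in> ball 0 r0 \<Longrightarrow>
      F z \<noteq> 0 \<and> f' z / F z \<in> ball 1 1 \<and> of_real a * Ln (f' z / F z) \<in> ball 0 1"
    unfolding eventually_nhds_metric by (auto simp: dist_commute)
  define r where "r = min r0 1"
  have r: "0 < r" "r \<le> 1" "ball 0 r \<subseteq> unit_disc" using \<open>r0 > 0\<close> by (auto simp: r_def)
  have rr: "F z \<noteq> 0" "f' z / F z \<in> ball 1 1" "norm (of_real a * Ln (f' z / F z)) < 1"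
    if "z \<in> ball 0 r" for z using r0[of z] that by (auto simp: r_def)
  have nonpos: "u \<notin> \<real>\<^sub>\<le>\<^sub>0" if "u \<in> ball 1 1" for u :: complex
    using that abs_Re_le_cmod[of "1 - u"] by (auto simp: complex_nonpos_Reals_iff dist_norm)
  show ?thesis
  proof (rule that[of r "\<lambda>z. Ln (f' z / F z)"])
    show "(\<lambda>z. Ln (f' z / F z)) holomorphic_on ball 0 r"
      by (intro holomorphic_intros holomorphic_on_subset[OF F] holomorphic_on_subset[OF f'] r)
         (use rr nonpos in blast)+
    show "f' z = F z * exp (Ln (f' z / F z))" if "z \<in> ball 0 r" for z
    proof -
      have "f' z / F z \<noteq> 0" using rr(2)[OF that] by auto
      then show ?thesis using rr(1)[OF that] by (simp add: exp_Ln)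
    qed
  qed (use r rr F0 f'0 in auto)
qed

text \<open>\<open>remove_sings\<close> depends only on the limit at \<open>z\<close>, so agreement
  on a punctured neighbourhood suffices.\<close>

lemma remove_sings_eq_continuous:
  assumes "\<forall>\<^sub>F x in at z. f x = g x" and "isCont g z"
  shows "remove_sings f z = g z"
  using assms(2) tendsto_cong[OF assms(1)] by (intro remove_sings_eqI) (simp add: isCont_def)

theorem mainTheorem3:
  fixes n :: nat and \<alpha> \<beta> :: real and f :: "complex \<Rightarrow> complex"
  assumes "0 \<le> \<alpha>" and "\<alpha> < 1" and "\<beta> > 0"
    and "n = 0 \<Longrightarrow> \<beta> \<ge> exp 1 * (1 - \<alpha>)"
    and "n \<noteq> 0 \<Longrightarrow> \<beta> \<ge> exp (real n - 1) * (1 - \<alpha>)"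
    and "f \<in> class_H"
    and "subordinate
           (remove_sings (\<lambda>z. 1 + of_real \<beta> * (z * deriv f z / f z) powi (1 - int n) *
              (1 - z * deriv f z / f z + z * deriv (deriv f) z / deriv f z)))
           (\<lambda>z. 1 + of_real (1 - \<alpha>) * z)"
  shows "f \<in> class_S_e"
proof -
  define E where "E z = 1 + of_real \<beta> * (z * deriv f z / f z) powi (1 - int n) *
              (1 - z * deriv f z / f z + z * deriv (deriv f) z / deriv f z)" for z
  define a where "a = 1 - real n"
  define c where "c = (1 - \<alpha>) / \<beta>"
  have c: "c > 0" using assms by (simp add: c_def)
  have cn: "c \<le> exp (- 1)" if "n = 0"
    using assms(4)[OF that] assms(3) by (simp add: c_def exp_minus field_simps)
  have cn': "c \<le> exp (1 - real n)" if "n \<noteq> 0"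
    using assms(5)[OF that] assms(3) by (simp add: c_def exp_diff field_simps)
  have fhol: "f holomorphic_on unit_disc" and f0: "f 0 = 0" and df0: "deriv f 0 = 1"
    using assms(6) by (auto simp: class_H_def)
  have dfhol: "deriv f holomorphic_on unit_disc"
    by (rule holomorphic_deriv[OF fhol open_ball])
  obtain F where F: "F holomorphic_on unit_disc" and fF: "\<And>z. z \<in> unit_disc \<Longrightarrow> f z = z * F z"
    and F0: "F 0 = 1"
    using Schwarz3[OF fhol f0] df0 by (metis mem_ball_0)
  have F': "(F has_field_derivative deriv F z) (at z)" if "z \<in> unit_disc" for z
    using holomorphic_derivI[OF F open_ball that] .
  have dfF: "deriv f z = F z + z * deriv F z" if "z \<in> unit_disc" for z
  proof (rule DERIV_imp_deriv)
    have "((\<lambda>z. z * F z) has_field_derivative F z + z * deriv F z) (at z)"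
      by (rule derivative_eq_intros F' that refl)+ simp
    then show "(f has_field_derivative F z + z * deriv F z) (at z)"
      by (rule has_field_derivative_transform_within_open[OF _ open_ball that]) (simp add: fF)
  qed
  obtain w where w: "w holomorphic_on unit_disc" "w 0 = 0"
    and w1: "\<And>z. z \<in> unit_disc \<Longrightarrow> norm (w z) < 1"
    and wE: "\<And>z. z \<in> unit_disc \<Longrightarrow> remove_sings E z = 1 + of_real (1 - \<alpha>) * w z"
    using assms(7) unfolding subordinate_def E_def[abs_def] by blast
  obtain v where v: "v holomorphic_on unit_disc" and wv: "\<And>z. z \<in> unit_disc \<Longrightarrow> w z = z * v z"
    and v0: "deriv w 0 = v 0"
    using Schwarz3[OF w] by (metis mem_ball_0)
  \<comment> \<open>Both parts of the Schwarz lemma enter: v(0) = w'(0), and elsewhere |w(z)| \<le>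
    |z|.\<close>
  have v1: "norm (v z) \<le> 1" if "z \<in> unit_disc" for z
  proof (cases "z = 0")
    case True
    then show ?thesis using Schwarz_Lemma(2)[OF w, of 0] w1 v0 by simp
  next
    case False
    have "norm (z * v z) \<le> norm z"
      using Schwarz_Lemma(1)[OF w, of z] w1 that wv by simp
    with False show ?thesis by (simp add: norm_mult)
  qed
  have ghol: "(\<lambda>z. of_real c * v z) holomorphic_on unit_disc"
    by (intro holomorphic_intros v)
  have gle: "norm (of_real c * v z) \<le> c" if "z \<in> unit_disc" for z
    using v1[OF that] c by (simp add: norm_mult)
  have "n = 1" if "a = 0" using that by (simp add: a_def)
  then have c1: "c \<le> 1" if "a = 0" using cn' that by simp
  have c2: "\<bar>a\<bar> * c \<le> 1 - exp (- \<bar>a\<bar>)"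
    unfolding a_def using cn cn' by (rule mult_exp_minus_abs_le)
  obtain W where W: "W holomorphic_on unit_disc" "W 0 = 0"
    and W1: "\<And>z. z \<in> unit_disc \<Longrightarrow> norm (W z) < 1"
    and Wuniq: "\<And>r l l' z. \<lbrakk>r \<le> 1; \<And>z. z \<in> ball 0 r \<Longrightarrow> (l has_field_derivative l' z) (at z); l 0 = 0;
       \<And>z. z \<in> ball 0 r \<Longrightarrow> norm (of_real a * l z) < pi;
       \<And>z. z \<in> ball 0 r \<Longrightarrow> exp (of_real a * l z) * l' z = of_real c * v z; z \<in> ball 0 r\<rbrakk> \<Longrightarrow> l z = W z"
    using exp_weighted_ODE_global_solution[OF ghol gle c c1 c2] by blast
  obtain r l where r: "0 < r" "r \<le> 1" and l: "l holomorphic_on ball 0 r" and l0: "l 0 = 0"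
    and l1: "\<And>z. z \<in> ball 0 r \<Longrightarrow> norm (of_real a * l z) < 1"
    and Fn: "\<And>z. z \<in> ball 0 r \<Longrightarrow> F z \<noteq> 0"
    and dfl: "\<And>z. z \<in> ball 0 r \<Longrightarrow> deriv f z = F z * exp (l z)"
    using local_logarithm_of_log_derivative[OF F dfhol F0 df0] by metis
  have l': "(l has_field_derivative deriv l z) (at z)" if "z \<in> ball 0 r" for z
    using holomorphic_derivI[OF l open_ball that] .
  have sub: "z \<in> unit_disc" if "z \<in> ball 0 r" for z using that r by simp
  define G where "G z = 1 + of_real \<beta> * (z * (exp (of_real a * l z) * deriv l z))" for z
  have ddf: "deriv (deriv f) z = deriv F z * exp (l z) + F z * exp (l z) * deriv l z"
    if "z \<in> ball 0 r" for z
  proof (rule DERIV_imp_deriv)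
    have "((\<lambda>z. F z * exp (l z)) has_field_derivative
        deriv F z * exp (l z) + F z * exp (l z) * deriv l z) (at z)"
      by (rule derivative_eq_intros F' l' sub that refl)+ (simp add: algebra_simps)
    then show "(deriv f has_field_derivative
        deriv F z * exp (l z) + F z * exp (l z) * deriv l z) (at z)"
      by (rule has_field_derivative_transform_within_open[OF _ open_ball that]) (simp add: dfl)
  qed
  \<comment> \<open>With p = exp l, the last factor of \<open>E\<close> is z p' / p = z l'. The
    origin is excluded because there \<open>E\<close> contains the quotient 0 / 0 = 0.\<close>
  have EG: "E z = G z" if z: "z \<in> ball 0 r" "z \<noteq> 0" for z
  proof -
    have p: "z * deriv f z / f z = exp (l z)"
      using fF[OF sub[OF z(1)]] dfl[OF z(1)] Fn[OF z(1)] z(2) by simp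
    have pF: "exp (l z) = 1 + z * deriv F z / F z"
      using dfl[OF z(1)] dfF[OF sub[OF z(1)]] Fn[OF z(1)] by (simp add: field_simps)
    have "z * deriv (deriv f) z / deriv f z = z * deriv F z / F z + z * deriv l z"
      using Fn[OF z(1)] by (simp add: ddf[OF z(1)] dfl[OF z(1)] field_simps)
    then have "1 - z * deriv f z / f z + z * deriv (deriv f) z / deriv f z = z * deriv l z"
      unfolding p using pF by simp
    moreover have "(z * deriv f z / f z) powi (1 - int n) = exp (of_real a * l z)"
      unfolding p exp_power_int by (simp add: a_def)
    ultimately show ?thesis unfolding E_def G_def by (simp add: mult_ac)
  qed
  have Ghol: "G holomorphic_on ball 0 r"
    unfolding G_def[abs_def] by (intro holomorphic_intros l holomorphic_deriv open_ball)
  have GE: "G z = remove_sings E z" if "z \<in> ball 0 r" for z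
  proof (rule remove_sings_eq_continuous[symmetric])
    show "isCont G z"
      using Ghol that holomorphic_on_imp_continuous_on continuous_on_eq_continuous_at by blast
    show "\<forall>\<^sub>F x in at z. E x = G x"
      using eventually_at_in_open[OF open_ball that] eventually_neq_at_within[of 0 z]
      by eventually_elim (auto intro!: EG)
  qed
  have eq: "z * (of_real c * v z) = z * (exp (of_real a * l z) * deriv l z)"
    if "z \<in> ball 0 r" for z
  proof -
    have "of_real \<beta> * (z * (exp (of_real a * l z) * deriv l z)) = of_real (1 - \<alpha>) * (z * v z)"
      using GE[OF that] wE[OF sub[OF that]] wv[OF sub[OF that]] by (simp add: G_def)
    then show ?thesis using assms(3) by (simp add: c_def field_simps)
  qed
  \<comment> \<open>The factor \<open>z\<close> in \<open>eq\<close> cancels only off the origin;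
    the identity theorem supplies the value at 0.\<close>
  have ode: "exp (of_real a * l z) * deriv l z = of_real c * v z" if "z \<in> ball 0 r" for z
  proof (rule analytic_continuation_open[of "ball 0 r - {0}" "ball 0 r"
        "\<lambda>z. exp (of_real a * l z) * deriv l z" "\<lambda>z. of_real c * v z"])
    have "of_real (r / 2) \<in> ball (0::complex) r - {0}" using r by simp
    then show "ball (0::complex) r - {0} \<noteq> {}" by blast
    show "(\<lambda>z. exp (of_real a * l z) * deriv l z) holomorphic_on ball 0 r"
      by (intro holomorphic_intros l holomorphic_deriv open_ball)
    show "(\<lambda>z. of_real c * v z) holomorphic_on ball 0 r"
      using ghol by (rule holomorphic_on_subset) (use sub in blast)
    show "exp (of_real a * l y) * deriv l y = of_real c * v y" if "y \<in> ball 0 r - {0}" for y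
      using eq[of y] that by simp
  qed (use that in auto)
  have lW: "l z = W z" if "z \<in> ball 0 r" for z
  proof (rule Wuniq[of r l "deriv l", OF r(2) l' l0 _ ode that])
    show "norm (of_real a * l y) < pi" if "y \<in> ball 0 r" for y
      using l1[OF that] pi_gt3 by linarith
  qed
  have global: "deriv f z = F z * exp (W z)" if "z \<in> unit_disc" for z
  proof (rule analytic_continuation_open[of "ball 0 r" unit_disc "deriv f" "\<lambda>z. F z * exp (W z)"])
    show "(\<lambda>z. F z * exp (W z)) holomorphic_on unit_disc" by (intro holomorphic_intros F W)
  qed (use r dfhol that dfl lW in auto)
  have expW: "(\<lambda>z. exp (W z) - 1) holomorphic_on unit_disc" by (intro holomorphic_intros W)
  \<comment> \<open>Since W(0) = 0, (exp W - 1) / z extends holomorphically to 0. This turns z F' =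
    (exp W - 1) F into the regular equation F' = L F.\<close>
  obtain L where L: "L holomorphic_on unit_disc"
    and LW: "\<And>z. z \<in> unit_disc \<Longrightarrow> exp (W z) - 1 = z * L z"
    using Schwarz3[OF expW] W(2) by (metis mem_ball_0 exp_zero cancel_comm_monoid_add_class.diff_cancel)
  have LF: "L z * F z = deriv F z" if "z \<in> unit_disc" for z
  proof (rule analytic_continuation_open[of "unit_disc - {0}" unit_disc "\<lambda>z. L z * F z" "deriv F"])
    have "of_real (1 / 2) \<in> unit_disc - {0}" by simp
    then show "unit_disc - {0} \<noteq> {}" by blast
    show "(\<lambda>z. L z * F z) holomorphic_on unit_disc" by (intro holomorphic_intros L F)
    show "deriv F holomorphic_on unit_disc" by (rule holomorphic_deriv[OF F open_ball])
    fix z assume z: "z \<in> unit_disc - {0}"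
    have "z * deriv F z = (exp (W z) - 1) * F z"
      using global[of z] dfF[of z] z by (simp add: algebra_simps)
    then have "z * deriv F z = z * (L z * F z)" using LW[of z] z by simp
    then show "L z * F z = deriv F z" using z by simp
  qed (use that in auto)
  have Fnz: "F z \<noteq> 0" if "z \<in> unit_disc" for z
    by (rule linear_ODE_solution_nonzero[OF L _ _ that]) (use F' LF F0 in auto)
  have cW: "isCont (\<lambda>z. exp (W z)) z" if "z \<in> unit_disc" for z
    using W(1) that by (metis isCont_exp' continuous_on_eq_continuous_at holomorphic_on_imp_continuous_on open_ball)
  have S: "remove_sings (\<lambda>z. z * deriv f z / f z) z = exp (W z)" if "z \<in> unit_disc" for z
  proof (rule remove_sings_eq_continuous[where g = "\<lambda>z. exp (W z)"])
    \<comment> \<open>Off the origin f(x) = x F(x) is nonzero; the punctured neighbourhood is taken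
      to avoid 0 as well as \<open>z\<close>.\<close>
    show "\<forall>\<^sub>F x in at z. x * deriv f x / f x = exp (W x)"
      using eventually_at_in_open[OF open_ball that] eventually_neq_at_within[of 0 z]
      by eventually_elim (use Fnz in \<open>auto simp: fF global\<close>)
  qed (rule cW[OF that])
  have "(\<lambda>z. exp (W z)) holomorphic_on unit_disc" by (intro holomorphic_intros W)
  then have "remove_sings (\<lambda>z. z * deriv f z / f z) holomorphic_on unit_disc"
    by (rule holomorphic_transform) (simp add: S)
  moreover have "exp holomorphic_on unit_disc" by (intro holomorphic_intros)
  \<comment> \<open>The Schwarz function witnessing the subordination is \<open>W\<close>.\<close>
  ultimately have "subordinate (remove_sings (\<lambda>z. z * deriv f z / f z)) exp"
    unfolding subordinate_def using W W1 S by blast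
  with assms(6) show ?thesis by (simp add: class_S_e_def)
qed

end
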